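(* For each $n$, let $t^{(n)}$ be a cycle type of size $n$ and let $\tau_n$ be a uniformly random $t^{(n)}$-cyclic permutation. 1. If $t_1^{(n)}=O(\sqrt n)$ then $\frac{\mathrm{rec}^\downarrow(\tau_n)}{\log n}\to1$ in probability as $n\to\infty$. 2. If $\sqrt n=o(t_1^{(n)})$ and $t_1^{(n)}=o(n)$ then $\frac{\mathrm{rec}^\downarrow(\tau_n)}{\log n-\log t_1^{(n)}}\to2$ in probability as $n\to\infty$. 3. If $t_1^{(n)}=\Theta(n)$ then $\mathrm{rec}^\downarrow(\tau_n)=O_{\mathbf{P}}(1)$.
   Context: A cycle type of size $n$ is a sequence $t=(t_1,\dots,t_n)$ of nonnegative integers with $\sum_{p=1}^n p\,t_p=n$; a permutation of $[n]=\{1,\dots,n\}$ is $t$-cyclic if it has exactly $t_p$ cycles of length $p$ for every $p$ (fixed points are $1$-cycles). $\mathrm{rec}^\downarrow(\tau)$ is the number of low records (left-to-right minima) of $\tau$, i.e. of $i\in[n]$ such that $\tau(j)>\tau(i)$ for all $j<i$. A sequence of random variables $(X_n)$ is $O_{\mathbf{P}}(1)$ if $\sup_n\mathbf{P}(|X_n|>M)\to0$ as $M\to+\infty$. *)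

theory Defs
  imports
    "HOL-Probability.Probability"
    "HOL-Library.Landau_Symbols"
    "HOL-Combinatorics.Orbits"
begin

text \<open>
  A finite sequence \<open>(t\<^sub>1, \<dots>, t\<^sub>n)\<close> is represented by a function on \<open>nat\<close> of which only the values
  at \<open>1, \<dots>, n\<close> are ever used.
\<close>

definition cycle_type :: "nat \<Rightarrow> (nat \<Rightarrow> nat) \<Rightarrow> bool" where
  "cycle_type n t \<longleftrightarrow> (\<Sum>p = 1..n. p * t p) = n"

text \<open>The cycles of a permutation of \<open>[n]\<close> are its orbits; fixed points give singleton orbits.\<close>

definition num_cycles :: "nat \<Rightarrow> (nat \<Rightarrow> nat) \<Rightarrow> nat \<Rightarrow> nat" where
  "num_cycles n \<sigma> p = card {C \<in> orbit \<sigma> ` {1..n}. card C = p}"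

definition t_cyclic_perms :: "nat \<Rightarrow> (nat \<Rightarrow> nat) \<Rightarrow> (nat \<Rightarrow> nat) set" where
  "t_cyclic_perms n t = {\<sigma>. \<sigma> permutes {1..n} \<and> (\<forall>p\<in>{1..n}. num_cycles n \<sigma> p = t p)}"

definition low_records :: "nat \<Rightarrow> (nat \<Rightarrow> nat) \<Rightarrow> nat" where
  "low_records n \<sigma> = card {i \<in> {1..n}. \<forall>j\<in>{1..<i}. \<sigma> j > \<sigma> i}"

text \<open>The \<open>n\<close>-th variable may live on its own probability space \<open>M n\<close>.\<close>

definition tendsto_in_prob :: "(nat \<Rightarrow> 'a measure) \<Rightarrow> (nat \<Rightarrow> 'a \<Rightarrow> real) \<Rightarrow> real \<Rightarrow> bool" where
  "tendsto_in_prob M X c \<longleftrightarrow>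
     (\<forall>\<epsilon>>0. (\<lambda>n. measure (M n) {\<omega> \<in> space (M n). \<bar>X n \<omega> - c\<bar> > \<epsilon>}) \<longlonglongrightarrow> 0)"

text \<open>
  Sequences are indexed by \<open>n \<ge> 1\<close>. The supremum is that of a bounded nonempty set of reals as soon
  as each \<open>M n\<close> with \<open>n \<ge> 1\<close> is a probability space.
\<close>

definition bounded_in_prob :: "(nat \<Rightarrow> 'a measure) \<Rightarrow> (nat \<Rightarrow> 'a \<Rightarrow> real) \<Rightarrow> bool" where
  "bounded_in_prob M X \<longleftrightarrow>
     ((\<lambda>K::real. SUP n\<in>{1..}. measure (M n) {\<omega> \<in> space (M n). \<bar>X n \<omega>\<bar> > K}) \<longlongrightarrow> 0) at_top"

end

theory Submission
  imports Defs "HOL-Real_Asymp.Real_Asymp"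
begin

text \<open>
  Call a low record \<open>i\<close> of \<open>\<sigma>\<close> high if \<open>\<sigma> i > i\<close>. Reflecting the graph of \<open>\<sigma>\<close> in the diagonal turns the
  low records with \<open>\<sigma> i < i\<close> into the high low records of the inverse of \<open>\<sigma>\<close>, and at most one low
  record is a fixed point (lemma \<open>low_records_near_high_low_records\<close>). Since inversion preserves the
  cycle type, the number of low records is, up to an error of \<open>1\<close>, a sum of two identically
  distributed copies of the number of high low records. It thus suffices to bound the expected
  distance of one copy from a constant, however the two copies depend on each other.

  If \<open>i\<close> is a high low record, then \<open>\<sigma>\<close> pushes \<open>{1..i}\<close> off itself: every \<open>a \<le> i\<close> has
  \<open>\<sigma> a \<ge> \<sigma> i > i\<close>. On that event, conjugation by a permutation of \<open>{1..i}\<close> merely permutes the values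
  \<open>\<sigma> 1, \<dots>, \<sigma> i\<close>, so these are exchangeable and the smallest one comes last with probability
  \<open>1 / i\<close>. Writing \<open>q i\<close> for the probability of the event, the expected number of high low records
  is therefore the sum of \<open>q i / i\<close>, and for \<open>i < j\<close> both are high low records with probability
  exactly \<open>q j / (i * j)\<close>.

  The \<open>q i\<close> are controlled by a recursion. Given that \<open>{1..i}\<close> is pushed off itself, conjugation by
  permutations of the \<open>n - i\<close> remaining points shows that these all have the same chance of being a
  fixed point, of being hit from \<open>{1..i}\<close> and of being sent into \<open>{1..i}\<close>. There are \<open>k\<close>, \<open>i\<close> and \<open>i\<close>
  points of these kinds, where \<open>k\<close> is the number of fixed points of \<open>\<sigma>\<close>, and \<open>{1..i + 1}\<close> is pushed
  off itself unless \<open>i + 1\<close> is one of them. So \<open>q (i + 1)\<close> lies between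
  \<open>q i * (1 - (k + 2 * i) / (n - i))\<close> and \<open>q i * (1 - (k + i) / n)\<close>. Hence \<open>q i\<close> is close to \<open>1\<close>
  well below the threshold \<open>J = min (n / k) (sqrt n)\<close> and at most of order \<open>J / i\<close> above it.

  It follows that the number of high low records up to \<open>J\<close> has mean square distance at most
  \<open>2 + 11 * ln J\<close> from \<open>ln J\<close>, while the later ones have bounded mean. The expected distance of the
  number of low records from \<open>2 * ln J\<close> is then at most \<open>17 + 2 * sqrt (2 + 11 * ln J)\<close>, for every
  \<open>n\<close> and every cycle type (lemma \<open>mean_abs_low_records\<close>). The three regimes are Markov's inequality
  and the three behaviours of \<open>J\<close>: comparable to \<open>sqrt n\<close>; eventually equal to \<open>n / k\<close> and tending to
  infinity; bounded.
\<close>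

section \<open>Conjugation by transpositions\<close>

definition relabel :: "nat \<Rightarrow> nat \<Rightarrow> (nat \<Rightarrow> nat) \<Rightarrow> nat \<Rightarrow> nat" where
  "relabel a b \<sigma> = Transposition.transpose a b \<circ> \<sigma> \<circ> Transposition.transpose a b"

lemma relabel_relabel [simp]: "relabel a b (relabel a b \<sigma>) = \<sigma>"
  by (simp add: relabel_def fun_eq_iff)

lemma relabel_apply:
  "relabel a b \<sigma> x = Transposition.transpose a b (\<sigma> (Transposition.transpose a b x))"
  by (simp add: relabel_def)

lemma relabel_permutes:
  assumes "\<sigma> permutes A" "a \<in> A" "b \<in> A"
  shows "relabel a b \<sigma> permutes A"
  unfolding relabel_def using assms by (intro permutes_compose permutes_swap_id)

lemma orbit_relabel:
  "orbit (relabel a b \<sigma>) (Transposition.transpose a b x) = Transposition.transpose a b ` orbit \<sigma> x"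
proof -
  have pow: "(relabel a b \<sigma> ^^ m) (Transposition.transpose a b x)
      = Transposition.transpose a b ((\<sigma> ^^ m) x)" for m
    by (induction m) (simp_all add: relabel_apply)
  show ?thesis
    unfolding orbit_altdef pow by auto
qed

lemma num_cycles_relabel:
  assumes "a \<in> {1..n}" "b \<in> {1..n}"
  shows "num_cycles n (relabel a b \<sigma>) p = num_cycles n \<sigma> p"
proof -
  let ?T = "Transposition.transpose a b"
  have T: "?T ` {1..n} = {1..n}"
    using assms by (intro transpose_image_eq) blast
  have "orbit (relabel a b \<sigma>) ` {1..n} = orbit (relabel a b \<sigma>) ` ?T ` {1..n}"
    by (simp only: T)
  also have "\<dots> = (`) ?T ` orbit \<sigma> ` {1..n}"
    by (simp add: image_image orbit_relabel)
  finally have eq: "{C \<in> orbit (relabel a b \<sigma>) ` {1..n}. card C = p}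
      = (`) ?T ` {C \<in> orbit \<sigma> ` {1..n}. card C = p}"
    by (auto simp: card_image)
  have "inj ((`) ?T)"
    by (intro inj_on_image) simp
  then show ?thesis
    unfolding num_cycles_def eq by (simp add: card_image inj_on_subset[of _ UNIV])
qed

lemma num_cycles_inv:
  assumes "\<sigma> permutes {1..n}"
  shows "num_cycles n (inv \<sigma>) p = num_cycles n \<sigma> p"
proof -
  have "permutation \<sigma>"
    using assms permutation_permutes by blast
  then show ?thesis
    by (simp add: num_cycles_def orbit_inv_eq)
qed

lemma num_cycles_1_eq_card_fixed:
  assumes "\<sigma> permutes {1..n}"
  shows "num_cycles n \<sigma> 1 = card {c \<in> {1..n}. \<sigma> c = c}"
proof -
  have perm: "permutation \<sigma>"
    using assms permutation_permutes by blast
  have single: "card (orbit \<sigma> c) = 1 \<longleftrightarrow> \<sigma> c = c" for c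
  proof
    assume "card (orbit \<sigma> c) = 1"
    then obtain d where "orbit \<sigma> c = {d}"
      by (auto simp: card_1_singleton_iff)
    moreover have "c \<in> orbit \<sigma> c" "\<sigma> c \<in> orbit \<sigma> c"
      using permutation_self_in_orbit[OF perm] by (auto intro: orbit.base)
    ultimately show "\<sigma> c = c" by auto
  next
    assume "\<sigma> c = c"
    then have "orbit \<sigma> c = {c}" by (simp add: orbit_eq_singleton_iff)
    then show "card (orbit \<sigma> c) = 1" by simp
  qed
  have "{C \<in> orbit \<sigma> ` {1..n}. card C = 1} = (\<lambda>c. {c}) ` {c \<in> {1..n}. \<sigma> c = c}"
    (is "?L = ?R")
  proof (intro subset_antisym subsetI)
    fix C assume "C \<in> ?L"
    then obtain c where c: "c \<in> {1..n}" "C = orbit \<sigma> c" "card (orbit \<sigma> c) = 1" by auto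
    then have "\<sigma> c = c" "C = {c}" using single orbit_eq_singleton_iff[of \<sigma> c] by auto
    then show "C \<in> ?R" using c(1) by blast
  next
    fix C assume "C \<in> ?R"
    then obtain c where c: "c \<in> {1..n}" "\<sigma> c = c" "C = {c}" by auto
    then have "C = orbit \<sigma> c" using orbit_eq_singleton_iff[of \<sigma> c] by simp
    then have "C \<in> orbit \<sigma> ` {1..n}" using c(1) by (rule image_eqI)
    then show "C \<in> ?L" using c(3) by simp
  qed
  then show ?thesis
    unfolding num_cycles_def by (simp add: card_image)
qed

text \<open>
  The tool behind all symmetry arguments: the involutions \<open>\<phi> c\<close> of \<open>E\<close> make every point of \<open>C\<close>
  belong to the random set \<open>G\<close> with the probability that \<open>i\<close> has, and summing over \<open>C\<close> expresses this
  common probability by the mean size of \<open>C \<inter> G\<close>.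
\<close>

lemma card_mem_equivariant_set:
  fixes G :: "'s \<Rightarrow> 'c set"
  assumes "finite E" "finite C"
    and \<phi>: "\<And>c \<sigma>. c \<in> C \<Longrightarrow> \<sigma> \<in> E \<Longrightarrow> \<phi> c \<sigma> \<in> E \<and> \<phi> c (\<phi> c \<sigma>) = \<sigma>"
    and G: "\<And>c \<sigma>. c \<in> C \<Longrightarrow> \<sigma> \<in> E \<Longrightarrow> i \<in> G (\<phi> c \<sigma>) \<longleftrightarrow> c \<in> G \<sigma>"
  shows "card C * card {\<sigma> \<in> E. i \<in> G \<sigma>} = (\<Sum>\<sigma>\<in>E. card (C \<inter> G \<sigma>))"
proof -
  have eq: "card {\<sigma> \<in> E. c \<in> G \<sigma>} = card {\<sigma> \<in> E. i \<in> G \<sigma>}" if c: "c \<in> C" for c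
  proof (rule bij_betw_same_card, rule bij_betwI)
    show "\<phi> c \<in> {\<sigma> \<in> E. c \<in> G \<sigma>} \<rightarrow> {\<sigma> \<in> E. i \<in> G \<sigma>}"
      using \<phi>[OF c] G[OF c] by auto
    show "\<phi> c \<in> {\<sigma> \<in> E. i \<in> G \<sigma>} \<rightarrow> {\<sigma> \<in> E. c \<in> G \<sigma>}"
      using \<phi>[OF c] G[OF c] by (metis (no_types, lifting) Pi_I mem_Collect_eq)
  qed (use \<phi>[OF c] in auto)
  have "(\<Sum>\<sigma>\<in>E. card (C \<inter> G \<sigma>)) = (\<Sum>\<sigma>\<in>E. \<Sum>c\<in>C. if c \<in> G \<sigma> then 1 else 0)"
    using assms(2) by (intro sum.cong refl) (simp add: sum.If_cases Int_def)
  also have "\<dots> = (\<Sum>c\<in>C. \<Sum>\<sigma>\<in>E. if c \<in> G \<sigma> then 1 else 0)"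
    by (rule sum.swap)
  also have "\<dots> = (\<Sum>c\<in>C. card {\<sigma> \<in> E. c \<in> G \<sigma>})"
    using assms(1) by (intro sum.cong refl) (simp add: sum.If_cases Int_def)
  also have "\<dots> = card C * card {\<sigma> \<in> E. i \<in> G \<sigma>}"
    using eq by simp
  finally show ?thesis by simp
qed

section \<open>Low records above, below and on the diagonal\<close>

definition low_record :: "(nat \<Rightarrow> nat) \<Rightarrow> nat \<Rightarrow> bool" where
  "low_record \<sigma> i \<longleftrightarrow> (\<forall>j\<in>{1..<i}. \<sigma> i < \<sigma> j)"

definition high_low_records :: "nat \<Rightarrow> (nat \<Rightarrow> nat) \<Rightarrow> nat set" where
  "high_low_records n \<sigma> = {i \<in> {1..n}. low_record \<sigma> i \<and> i < \<sigma> i}"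

text \<open>
  Whether the point \<open>(i, \<sigma> i)\<close> of the graph of \<open>\<sigma>\<close> is a low record depends only on there being no
  point of the graph to its lower left. This condition is symmetric in the two coordinates, and two
  fixed points cannot both satisfy it.
\<close>

lemma low_records_near_high_low_records:
  assumes p: "\<sigma> permutes {1..n}"
  shows "\<bar>real (low_records n \<sigma>) - (real (card (high_low_records n \<sigma>)) + real (card (high_low_records n (inv \<sigma>))))\<bar> \<le> 1"
proof -
  let ?R = "{i \<in> {1..n}. low_record \<sigma> i}"
  let ?D = "{i \<in> ?R. \<sigma> i < i}" and ?F = "{i \<in> ?R. \<sigma> i = i}"
  have rangeI: "\<sigma> i \<in> {1..n} \<longleftrightarrow> i \<in> {1..n}" for i by (rule permutes_in_image[OF p])
  have inv1: "inv \<sigma> (\<sigma> i) = i" "\<sigma> (inv \<sigma> i) = i" for i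
    using permutes_inverses[OF p] by auto
  have img: "\<sigma> ` ?D \<subseteq> high_low_records n (inv \<sigma>)"
  proof (rule image_subsetI)
    fix i assume "i \<in> ?D"
    then have i: "i \<in> {1..n}" "low_record \<sigma> i" "\<sigma> i < i" by auto
    have "low_record (inv \<sigma>) (\<sigma> i)"
      unfolding low_record_def inv1
    proof
      fix w assume w: "w \<in> {1..<\<sigma> i}"
      then have "\<sigma> (inv \<sigma> w) < \<sigma> i" by (simp add: inv1)
      moreover have "1 \<le> inv \<sigma> w"
      proof -
        have "\<sigma> (inv \<sigma> w) \<in> {1..n}"
          using w i(1) rangeI[of i] by (simp add: inv1)
        then show ?thesis unfolding rangeI by simp
      qed
      moreover have "\<sigma> i < \<sigma> (inv \<sigma> w)" if "inv \<sigma> w \<in> {1..<i}"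
        using i(2) that unfolding low_record_def by blast
      ultimately have "\<not> inv \<sigma> w < i" by fastforce
      moreover have "inv \<sigma> w \<noteq> i" using \<open>\<sigma> (inv \<sigma> w) < \<sigma> i\<close> by auto
      ultimately show "i < inv \<sigma> w" by simp
    qed
    then show "\<sigma> i \<in> high_low_records n (inv \<sigma>)"
      using i rangeI[of i] by (simp add: high_low_records_def inv1)
  qed
  moreover have "high_low_records n (inv \<sigma>) \<subseteq> \<sigma> ` ?D"
  proof
    fix v assume "v \<in> high_low_records n (inv \<sigma>)"
    then have v: "v \<in> {1..n}" "low_record (inv \<sigma>) v" "v < inv \<sigma> v"
      by (simp_all add: high_low_records_def)
    let ?i = "inv \<sigma> v"
    have i: "?i \<in> {1..n}" using v(1) rangeI[of ?i] by (simp add: inv1)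
    have "low_record \<sigma> ?i"
      unfolding low_record_def inv1
    proof
      fix j assume j: "j \<in> {1..<?i}"
      then have "\<sigma> j \<in> {1..n}" unfolding rangeI using i by auto
      moreover have "inv \<sigma> (\<sigma> j) < inv \<sigma> v" using j by (simp add: inv1)
      moreover have "inv \<sigma> v < inv \<sigma> (\<sigma> j)" if "\<sigma> j \<in> {1..<v}"
        using v(2) that unfolding low_record_def by blast
      ultimately have "\<not> \<sigma> j < v" by fastforce
      moreover have "\<sigma> j \<noteq> v" using \<open>inv \<sigma> (\<sigma> j) < inv \<sigma> v\<close> by auto
      ultimately show "v < \<sigma> j" by simp
    qed
    then have "?i \<in> ?D" using i v by (simp add: inv1)
    then show "v \<in> \<sigma> ` ?D" by (rule rev_image_eqI) (simp add: inv1)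
  qed
  ultimately have "\<sigma> ` ?D = high_low_records n (inv \<sigma>)" by blast
  then have D: "card ?D = card (high_low_records n (inv \<sigma>))"
    using card_image[OF permutes_inj_on[OF p], of ?D] by simp
  have F: "card ?F \<le> 1"
  proof -
    have "\<not> i < j" if "i \<in> ?F" "j \<in> ?F" for i j
    proof
      assume "i < j"
      then have "i \<in> {1..<j}" using that by simp
      then have "\<sigma> j < \<sigma> i" using that unfolding low_record_def by blast
      then show False using that \<open>i < j\<close> by simp
    qed
    then have "\<forall>i\<in>?F. \<forall>j\<in>?F. i = j" by (meson linorder_neqE_nat)
    moreover have "finite ?F" by simp
    ultimately show ?thesis unfolding One_nat_def by (simp only: card_le_Suc0_iff_eq)
  qed
  have "low_records n \<sigma> = card ?R"
    by (simp add: low_records_def low_record_def)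
  also have "?R = (high_low_records n \<sigma> \<union> ?D) \<union> ?F"
    by (auto simp: high_low_records_def)
  also have "card \<dots> = card (high_low_records n \<sigma> \<union> ?D) + card ?F"
    by (intro card_Un_disjoint) (auto simp: high_low_records_def)
  also have "card (high_low_records n \<sigma> \<union> ?D) = card (high_low_records n \<sigma>) + card ?D"
    by (intro card_Un_disjoint) (auto simp: high_low_records_def)
  finally show ?thesis using D F by simp
qed

section \<open>Initial segments pushed off themselves\<close>

text \<open>
  The permutations of a given cycle type enter only through these closure properties and their
  number \<open>k\<close> of fixed points.
\<close>

locale conj_invariant_perms =
  fixes n k :: nat and S :: "(nat \<Rightarrow> nat) set"
  assumes nonempty: "S \<noteq> {}"
    and permutes: "\<And>\<sigma>. \<sigma> \<in> S \<Longrightarrow> \<sigma> permutes {1..n}"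
    and relabel_closed: "\<And>\<sigma> a b. \<lbrakk>\<sigma> \<in> S; a \<in> {1..n}; b \<in> {1..n}\<rbrakk> \<Longrightarrow> relabel a b \<sigma> \<in> S"
    and inv_closed: "\<And>\<sigma>. \<sigma> \<in> S \<Longrightarrow> inv \<sigma> \<in> S"
    and card_fixed: "\<And>\<sigma>. \<sigma> \<in> S \<Longrightarrow> card {c \<in> {1..n}. \<sigma> c = c} = k"
begin

lemma finite_S: "finite S"
  by (rule finite_subset[OF _ finite_permutations[of "{1..n}"]]) (use permutes in auto)

lemma card_S_pos: "card S > 0"
  using nonempty finite_S by (simp add: card_gt_0_iff)

lemma k_le_n: "k \<le> n"
proof -
  obtain \<sigma> where "\<sigma> \<in> S" using nonempty by auto
  then have "k = card {c \<in> {1..n}. \<sigma> c = c}" using card_fixed by simp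
  also have "\<dots> \<le> card {1..n}" by (intro card_mono) auto
  finally show ?thesis by simp
qed

definition pushed :: "nat \<Rightarrow> (nat \<Rightarrow> nat) set" where
  "pushed i = {\<sigma> \<in> S. \<forall>a\<in>{1..i}. i < \<sigma> a}"

lemma pushedD: "\<sigma> \<in> pushed i \<Longrightarrow> 1 \<le> a \<Longrightarrow> a \<le> i \<Longrightarrow> i < \<sigma> a"
  by (simp add: pushed_def)

lemma pushed_permutes: "\<sigma> \<in> pushed i \<Longrightarrow> \<sigma> permutes {1..n}"
  using permutes by (auto simp only: pushed_def)

lemma finite_pushed: "finite (pushed i)"
  using finite_S by (simp add: pushed_def)

lemma pushed_antimono: "i \<le> j \<Longrightarrow> pushed j \<subseteq> pushed i"
  unfolding pushed_def by (intro Collect_mono conj_mono impI) (auto intro: le_less_trans)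

lemma relabel_pushed_above:
  assumes "\<sigma> \<in> pushed i" "c \<in> {Suc i..n}"
  shows "relabel (Suc i) c \<sigma> \<in> pushed i"
  using assms relabel_closed[of \<sigma> "Suc i" c]
  by (auto simp: pushed_def relabel_apply Transposition.transpose_def)

text \<open>
  The next three lemmas let the new point \<open>Suc i\<close> obstruct \<open>pushed (Suc i)\<close> in its three possible
  ways. In each, \<open>Suc i\<close> may be exchanged with any of the \<open>n - i\<close> points outside \<open>{1..i}\<close>, and all of
  the \<open>k\<close> fixed points, \<open>i\<close> images and \<open>i\<close> preimages lie among these.
\<close>

lemma pushed_fixes_next:
  assumes "i < n"
  shows "(n - i) * card {\<sigma> \<in> pushed i. \<sigma> (Suc i) = Suc i} = k * card (pushed i)"
proof -
  have "card {Suc i..n} * card {\<sigma> \<in> pushed i. Suc i \<in> {c. \<sigma> c = c}}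
      = (\<Sum>\<sigma>\<in>pushed i. card ({Suc i..n} \<inter> {c. \<sigma> c = c}))"
    by (rule card_mem_equivariant_set[where \<phi> = "relabel (Suc i)"])
       (auto simp: finite_pushed relabel_pushed_above relabel_apply transpose_eq_iff)
  also have "\<dots> = (\<Sum>\<sigma>\<in>pushed i. k)"
  proof (rule sum.cong)
    fix \<sigma> assume \<sigma>: "\<sigma> \<in> pushed i"
    have "Suc i \<le> c" if "\<sigma> c = c" "1 \<le> c" for c
      using pushedD[OF \<sigma>, of c] that by (cases "c \<le> i") auto
    then have "{Suc i..n} \<inter> {c. \<sigma> c = c} = {c \<in> {1..n}. \<sigma> c = c}"
      by auto
    moreover have "\<sigma> \<in> S" using \<sigma> by (simp add: pushed_def)
    ultimately show "card ({Suc i..n} \<inter> {c. \<sigma> c = c}) = k"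
      by (simp only: card_fixed)
  qed simp
  finally show ?thesis by simp
qed

lemma pushed_hits_next:
  assumes "i < n"
  shows "(n - i) * card {\<sigma> \<in> pushed i. Suc i \<in> \<sigma> ` {1..i}} = i * card (pushed i)"
proof -
  have "card {Suc i..n} * card {\<sigma> \<in> pushed i. Suc i \<in> \<sigma> ` {1..i}}
      = (\<Sum>\<sigma>\<in>pushed i. card ({Suc i..n} \<inter> \<sigma> ` {1..i}))"
  proof (rule card_mem_equivariant_set[where \<phi> = "relabel (Suc i)"])
    fix c \<sigma> assume c: "c \<in> {Suc i..n}" and \<sigma>: "\<sigma> \<in> pushed i"
    have "relabel (Suc i) c \<sigma> ` {1..i} = Transposition.transpose (Suc i) c ` \<sigma> ` {1..i}"
      unfolding image_image using c
      by (intro image_cong) (auto simp: relabel_apply Transposition.transpose_def)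
    then show "(Suc i \<in> relabel (Suc i) c \<sigma> ` {1..i}) = (c \<in> \<sigma> ` {1..i})"
      by (auto simp: in_transpose_image_iff)
  qed (auto simp: finite_pushed relabel_pushed_above)
  also have "\<dots> = (\<Sum>\<sigma>\<in>pushed i. i)"
  proof (rule sum.cong)
    fix \<sigma> assume \<sigma>: "\<sigma> \<in> pushed i"
    then have p: "\<sigma> permutes {1..n}" by (rule pushed_permutes)
    have "\<sigma> ` {1..i} \<subseteq> {Suc i..n}"
    proof (rule image_subsetI)
      fix a assume a: "a \<in> {1..i}"
      then have "\<sigma> a \<in> {1..n}" using assms by (simp only: permutes_in_image[OF p]) simp
      then show "\<sigma> a \<in> {Suc i..n}" using pushedD[OF \<sigma>, of a] a by simp
    qed
    then have "{Suc i..n} \<inter> \<sigma> ` {1..i} = \<sigma> ` {1..i}" by auto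
    then show "card ({Suc i..n} \<inter> \<sigma> ` {1..i}) = i"
      by (simp add: card_image permutes_inj_on[OF p])
  qed simp
  finally show ?thesis by simp
qed

lemma pushed_next_hits_back:
  assumes "i < n"
  shows "(n - i) * card {\<sigma> \<in> pushed i. \<sigma> (Suc i) \<in> {1..i}} = i * card (pushed i)"
proof -
  have "card {Suc i..n} * card {\<sigma> \<in> pushed i. Suc i \<in> \<sigma> -` {1..i}}
      = (\<Sum>\<sigma>\<in>pushed i. card ({Suc i..n} \<inter> \<sigma> -` {1..i}))"
    by (rule card_mem_equivariant_set[where \<phi> = "relabel (Suc i)"])
       (auto simp: finite_pushed relabel_pushed_above relabel_apply Transposition.transpose_def)
  also have "\<dots> = (\<Sum>\<sigma>\<in>pushed i. i)"
  proof (rule sum.cong)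
    fix \<sigma> assume \<sigma>: "\<sigma> \<in> pushed i"
    then have p: "\<sigma> permutes {1..n}" by (rule pushed_permutes)
    have "x \<in> {Suc i..n}" if "\<sigma> x \<in> {1..i}" for x
    proof -
      have "\<sigma> x \<in> {1..n}" using that assms by auto
      then have x: "x \<in> {1..n}" by (simp only: permutes_in_image[OF p])
      have "i < \<sigma> x" if "x \<le> i" using that x \<sigma> by (simp add: pushed_def)
      then show ?thesis using x that by force
    qed
    then have "{Suc i..n} \<inter> \<sigma> -` {1..i} = \<sigma> -` {1..i}" by auto
    moreover have "card (\<sigma> -` {1..i}) = card {1..i}"
      using permutes_bij[OF p] by (intro card_vimage_inj) (auto simp: bij_def)
    ultimately show "card ({Suc i..n} \<inter> \<sigma> -` {1..i}) = i" by simp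
  qed simp
  finally show ?thesis by simp
qed

lemma pushed_minus_pushed_Suc:
  assumes "i < n"
  shows "pushed i - pushed (Suc i) = {\<sigma> \<in> pushed i. \<sigma> (Suc i) = Suc i}
    \<union> {\<sigma> \<in> pushed i. Suc i \<in> \<sigma> ` {1..i}} \<union> {\<sigma> \<in> pushed i. \<sigma> (Suc i) \<in> {1..i}}" (is "?L = ?R")
proof (intro subset_antisym subsetI)
  fix \<sigma> assume "\<sigma> \<in> ?L"
  then obtain a where \<sigma>: "\<sigma> \<in> pushed i" and a: "a \<in> {1..Suc i}" "\<sigma> a \<le> Suc i"
    by (auto simp: pushed_def not_less)
  then have p: "\<sigma> permutes {1..n}" using permutes by (auto simp only: pushed_def)
  show "\<sigma> \<in> ?R"
  proof (cases "a = Suc i")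
    case True
    have "\<sigma> (Suc i) \<in> {1..n}"
      using assms permutes_in_image[OF p] by auto
    then show ?thesis using True \<sigma> a by auto
  next
    case False
    then have "a \<in> {1..i}" "i < \<sigma> a" using a \<sigma> by (auto simp: pushed_def)
    then have "\<sigma> a = Suc i" using a by auto
    then show ?thesis using \<open>a \<in> {1..i}\<close> \<sigma> by force
  qed
next
  fix \<sigma> assume R: "\<sigma> \<in> ?R"
  then have "\<exists>a\<in>{1..Suc i}. \<sigma> a \<le> Suc i"
  proof (elim UnE CollectE conjE)
    assume "Suc i \<in> \<sigma> ` {1..i}"
    then obtain a where "a \<in> {1..i}" "Suc i = \<sigma> a" by blast
    then show ?thesis by (intro bexI[of _ a]) auto
  qed (auto intro!: bexI[of _ "Suc i"])
  then have "\<sigma> \<notin> pushed (Suc i)"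
    unfolding pushed_def by (auto simp: not_less)
  then show "\<sigma> \<in> ?L" using R by auto
qed

text \<open>
  Relabelling by a permutation of \<open>{1..i}\<close> permutes the values \<open>\<sigma> 1, \<dots>, \<sigma> i\<close> without changing them, as
  they all exceed \<open>i\<close>. Each position is thus equally likely to hold the smallest value.
\<close>

lemma low_record_exchange:
  assumes E: "E \<subseteq> pushed i" and i: "1 \<le> i" "i \<le> n"
    and closed: "\<And>\<sigma> c. \<sigma> \<in> E \<Longrightarrow> c \<in> {1..i} \<Longrightarrow> relabel i c \<sigma> \<in> E"
  shows "i * card {\<sigma> \<in> E. low_record \<sigma> i} = card E"
proof -
  define G where "G \<sigma> = {a \<in> {1..i}. \<forall>b\<in>{1..i}. \<sigma> a \<le> \<sigma> b}" for \<sigma> :: "nat \<Rightarrow> nat"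
  have finE: "finite E" using E finite_pushed finite_subset by blast
  have inj: "inj \<sigma>" if "\<sigma> \<in> E" for \<sigma>
    using that E permutes permutes_inj unfolding pushed_def by blast
  have rec: "low_record \<sigma> i \<longleftrightarrow> i \<in> G \<sigma>" if "\<sigma> \<in> E" for \<sigma>
  proof -
    have "\<sigma> i \<noteq> \<sigma> j" if "j < i" for j
      using injD[OF inj[OF \<open>\<sigma> \<in> E\<close>], of i j] that by auto
    then have lt: "\<sigma> i < \<sigma> j \<longleftrightarrow> \<sigma> i \<le> \<sigma> j" if "j < i" for j
      using that by (simp add: less_le)
    have "{1..i} = insert i {1..<i}" using i by auto
    then show ?thesis
      using i lt by (simp add: low_record_def G_def)
  qed
  have "card {1..i} * card {\<sigma> \<in> E. i \<in> G \<sigma>} = (\<Sum>\<sigma>\<in>E. card ({1..i} \<inter> G \<sigma>))"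
  proof (rule card_mem_equivariant_set[where \<phi> = "relabel i"])
    fix c \<sigma> assume c: "c \<in> {1..i}" and \<sigma>: "\<sigma> \<in> E"
    let ?T = "Transposition.transpose i c"
    have T: "?T ` {1..i} = {1..i}" using c i by auto
    have val: "relabel i c \<sigma> a = \<sigma> (?T a)" if "a \<in> {1..i}" for a
    proof -
      have "?T a \<in> {1..i}" using that T by blast
      then have "i < \<sigma> (?T a)" using \<sigma> E by (auto simp: pushed_def)
      then show ?thesis using c by (auto simp: relabel_apply Transposition.transpose_def)
    qed
    have "i \<in> G (relabel i c \<sigma>) \<longleftrightarrow> (\<forall>b\<in>{1..i}. \<sigma> c \<le> \<sigma> (?T b))"
      using i by (simp add: G_def val)
    also have "\<dots> \<longleftrightarrow> (\<forall>b\<in>?T ` {1..i}. \<sigma> c \<le> \<sigma> b)" by blast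
    also have "\<dots> \<longleftrightarrow> c \<in> G \<sigma>" unfolding T using c by (simp add: G_def)
    finally show "i \<in> G (relabel i c \<sigma>) \<longleftrightarrow> c \<in> G \<sigma>" .
  qed (use closed finE in auto)
  also have "\<dots> = (\<Sum>\<sigma>\<in>E. 1)"
  proof (rule sum.cong)
    fix \<sigma> assume \<sigma>: "\<sigma> \<in> E"
    obtain a where a: "a \<in> {1..i}" "\<And>b. b \<in> {1..i} \<Longrightarrow> \<sigma> a \<le> \<sigma> b"
      using ex_min_if_finite[of "\<sigma> ` {1..i}"] i by (force simp: not_less)
    have "x = a" if "x \<in> G \<sigma>" for x
    proof (rule injD[OF inj[OF \<sigma>]])
      show "\<sigma> x = \<sigma> a" using that a by (intro antisym) (simp_all add: G_def)
    qed
    moreover have "a \<in> G \<sigma>" using a by (simp add: G_def)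
    ultimately have "{1..i} \<inter> G \<sigma> = {a}" using a(1) by blast
    then show "card ({1..i} \<inter> G \<sigma>) = 1" by simp
  qed simp
  finally show ?thesis using rec by (simp cong: conj_cong)
qed

lemma relabel_pushed_below:
  assumes "\<sigma> \<in> pushed j" "j \<le> n" "i \<in> {1..j}" "c \<in> {1..j}"
  shows "relabel i c \<sigma> \<in> pushed j" "\<And>a. a \<in> {1..j} \<Longrightarrow> relabel i c \<sigma> a = \<sigma> (Transposition.transpose i c a)"
proof -
  let ?T = "Transposition.transpose i c"
  show val: "relabel i c \<sigma> a = \<sigma> (?T a)" if "a \<in> {1..j}" for a
  proof -
    have "?T a \<in> {1..j}" using that assms by (auto simp: Transposition.transpose_def)
    then have "j < \<sigma> (?T a)" using assms(1) by (auto simp: pushed_def)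
    then show ?thesis using assms by (auto simp: relabel_apply Transposition.transpose_def)
  qed
  have "relabel i c \<sigma> \<in> S" using assms by (intro relabel_closed) (auto simp: pushed_def)
  moreover have "j < relabel i c \<sigma> a" if "a \<in> {1..j}" for a
  proof -
    have "?T a \<in> {1..j}" using that assms by (auto simp: Transposition.transpose_def)
    then show ?thesis using assms(1) val[OF that] by (auto simp: pushed_def)
  qed
  ultimately show "relabel i c \<sigma> \<in> pushed j" by (auto simp: pushed_def)
qed

lemma card_pushed_low_record:
  assumes "i \<in> {1..n}"
  shows "i * card {\<sigma> \<in> pushed i. low_record \<sigma> i} = card (pushed i)"
  using assms by (intro low_record_exchange) (auto intro!: relabel_pushed_below)

text \<open>
  Exchanging positions up to \<open>i < j\<close> does not affect whether \<open>j\<close> is a low record, so the exchange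
  argument can be repeated inside the event for \<open>j\<close>.
\<close>

lemma card_pushed_low_record2:
  assumes "i \<in> {1..n}" "j \<in> {1..n}" "i < j"
  shows "i * j * card {\<sigma> \<in> pushed j. low_record \<sigma> i \<and> low_record \<sigma> j} = card (pushed j)"
proof -
  let ?E = "{\<sigma> \<in> pushed j. low_record \<sigma> j}"
  have "i * card {\<sigma> \<in> ?E. low_record \<sigma> i} = card ?E"
  proof (rule low_record_exchange)
    show "?E \<subseteq> pushed i" using pushed_antimono[of i j] assms by auto
    fix \<sigma> c assume \<sigma>: "\<sigma> \<in> ?E" and c: "c \<in> {1..i}"
    let ?T = "Transposition.transpose i c"
    have "\<sigma> \<in> pushed j" "j \<le> n" "i \<in> {1..j}" "c \<in> {1..j}"
      using \<sigma> c assms by auto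
    note rp = relabel_pushed_below[OF this]
    have "low_record (relabel i c \<sigma>) j"
      unfolding low_record_def
    proof
      fix l assume l: "l \<in> {1..<j}"
      have "?T l \<in> {1..<j}" using l c assms by (auto simp: Transposition.transpose_def)
      moreover have "?T j = j" using c assms by (auto simp: Transposition.transpose_def)
      ultimately show "relabel i c \<sigma> j < relabel i c \<sigma> l"
        using \<sigma> l assms rp(2)[of l] rp(2)[of j] by (auto simp: low_record_def)
    qed
    then show "relabel i c \<sigma> \<in> ?E" using rp(1) by simp
  qed (use assms in auto)
  moreover have "{\<sigma> \<in> ?E. low_record \<sigma> i} = {\<sigma> \<in> pushed j. low_record \<sigma> i \<and> low_record \<sigma> j}"
    by auto
  ultimately have "i * card {\<sigma> \<in> pushed j. low_record \<sigma> i \<and> low_record \<sigma> j} = card ?E"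
    by (simp only:)
  then have "j * (i * card {\<sigma> \<in> pushed j. low_record \<sigma> i \<and> low_record \<sigma> j}) = card (pushed j)"
    using card_pushed_low_record[OF assms(2)] by (simp only:)
  then show ?thesis by (simp only: mult.assoc mult.left_commute)
qed

text \<open>
  A low record at \<open>i\<close> has the smallest value so far; if that value exceeds \<open>i\<close>, all of them do.
\<close>

lemma mem_high_low_records_iff:
  assumes "\<sigma> \<in> S" "i \<in> {1..n}"
  shows "i \<in> high_low_records n \<sigma> \<longleftrightarrow> \<sigma> \<in> pushed i \<and> low_record \<sigma> i"
proof
  assume "i \<in> high_low_records n \<sigma>"
  then have R: "low_record \<sigma> i" "i < \<sigma> i" by (simp_all add: high_low_records_def)
  have "i < \<sigma> a" if "a \<in> {1..i}" for a
  proof (cases "a = i")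
    case False
    then have "a \<in> {1..<i}" using that by simp
    then have "\<sigma> i < \<sigma> a" using R(1) unfolding low_record_def by blast
    then show ?thesis using R(2) by (rule less_trans[rotated])
  qed (simp add: R(2))
  then show "\<sigma> \<in> pushed i \<and> low_record \<sigma> i"
    using R(1) assms(1) unfolding pushed_def by blast
next
  assume "\<sigma> \<in> pushed i \<and> low_record \<sigma> i"
  then show "i \<in> high_low_records n \<sigma>"
    using assms(2) pushedD[of \<sigma> i i] by (simp add: high_low_records_def)
qed

section \<open>The probability that an initial segment is pushed off itself\<close>

definition push_prob :: "nat \<Rightarrow> real" where
  "push_prob i = real (card (pushed i)) / real (card S)"

lemma push_prob_0 [simp]: "push_prob 0 = 1"
  using card_S_pos by (simp add: push_prob_def pushed_def)

lemma push_prob_nonneg: "0 \<le> push_prob i"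
  by (simp add: push_prob_def)

lemma push_prob_le_1: "push_prob i \<le> 1"
proof -
  have "card (pushed i) \<le> card S"
    using finite_S by (rule card_mono) (auto simp: pushed_def)
  then show ?thesis using card_S_pos by (simp add: push_prob_def)
qed

lemma card_pushed_diff:
  "real (card (pushed i)) - real (card (pushed (Suc i))) = real (card (pushed i - pushed (Suc i)))"
proof -
  have "pushed (Suc i) \<subseteq> pushed i" by (rule pushed_antimono) simp
  then have "card (pushed i - pushed (Suc i)) = card (pushed i) - card (pushed (Suc i))"
      "card (pushed (Suc i)) \<le> card (pushed i)"
    using finite_pushed by (auto intro: card_Diff_subset card_mono)
  then show ?thesis by (simp add: of_nat_diff)
qed

text \<open>
  Two of the three obstructions, that \<open>Suc i\<close> is fixed and that it is hit from \<open>{1..i}\<close>, exclude each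
  other, so their probabilities add up.
\<close>

lemma push_prob_Suc_le:
  assumes "i < n"
  shows "push_prob (Suc i) \<le> push_prob i * (1 - (real k + real i) / real n)"
proof -
  let ?F = "{\<sigma> \<in> pushed i. \<sigma> (Suc i) = Suc i}" and ?H = "{\<sigma> \<in> pushed i. Suc i \<in> \<sigma> ` {1..i}}"
  let ?c = "real (card (pushed i))"
  have disj: "?F \<inter> ?H = {}"
  proof (rule equals0I)
    fix \<sigma> assume \<sigma>: "\<sigma> \<in> ?F \<inter> ?H"
    then have "inj \<sigma>" using pushed_permutes permutes_inj by blast
    moreover obtain a where "a \<in> {1..i}" "\<sigma> a = Suc i" "\<sigma> (Suc i) = Suc i"
      using \<sigma> unfolding image_iff by auto
    ultimately show False using injD[of \<sigma> a "Suc i"] by simp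
  qed
  have "real (card ?F) + real (card ?H) = real (card (?F \<union> ?H))"
    using disj finite_pushed[of i] by (simp add: card_Un_disjoint)
  also have "\<dots> \<le> real (card (pushed i - pushed (Suc i)))"
    unfolding pushed_minus_pushed_Suc[OF assms] using finite_pushed
    by (intro of_nat_mono card_mono) auto
  finally have le: "real (card ?F) + real (card ?H) \<le> ?c - real (card (pushed (Suc i)))"
    by (simp add: card_pushed_diff)
  have "real (n - i) * real (card ?F) = real k * ?c"
    using arg_cong[OF pushed_fixes_next[OF assms], of real] by (simp only: of_nat_mult)
  moreover have "real (n - i) * real (card ?H) = real i * ?c"
    using arg_cong[OF pushed_hits_next[OF assms], of real] by (simp only: of_nat_mult)
  ultimately have "(real k + real i) * ?c = real (n - i) * (real (card ?F) + real (card ?H))"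
    by (simp add: algebra_simps)
  also have "\<dots> \<le> real n * (real (card ?F) + real (card ?H))"
    by (intro mult_right_mono) auto
  also have "\<dots> \<le> real n * (?c - real (card (pushed (Suc i))))"
    using le by (intro mult_left_mono) auto
  finally have "real (card (pushed (Suc i))) \<le> ?c * (1 - (real k + real i) / real n)"
    using assms by (simp add: field_simps)
  then show ?thesis
    using card_S_pos by (simp add: push_prob_def field_simps)
qed

text \<open>
  Union bound over the three obstructions; the restriction on \<open>i\<close> gives \<open>n - i \<ge> n / 2\<close>.
\<close>

lemma push_prob_Suc_ge:
  assumes "2 * i < n"
  shows "push_prob i - push_prob (Suc i) \<le> 2 * (real k + 2 * real i) / real n"
proof -
  let ?F = "{\<sigma> \<in> pushed i. \<sigma> (Suc i) = Suc i}" and ?H = "{\<sigma> \<in> pushed i. Suc i \<in> \<sigma> ` {1..i}}"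
    and ?B = "{\<sigma> \<in> pushed i. \<sigma> (Suc i) \<in> {1..i}}"
  let ?c = "real (card (pushed i))"
  have i: "i < n" using assms by simp
  have "card (pushed i - pushed (Suc i)) \<le> card ?F + card ?H + card ?B"
    unfolding pushed_minus_pushed_Suc[OF i] by (meson add_mono card_Un_le order_refl order_trans)
  then have "?c - real (card (pushed (Suc i))) \<le> real (card ?F) + real (card ?H) + real (card ?B)"
    unfolding card_pushed_diff by linarith
  moreover have "real (n - i) * real (card ?F) = real k * ?c"
    using arg_cong[OF pushed_fixes_next[OF i], of real] by (simp only: of_nat_mult)
  moreover have "real (n - i) * real (card ?H) = real i * ?c"
    using arg_cong[OF pushed_hits_next[OF i], of real] by (simp only: of_nat_mult)
  moreover have "real (n - i) * real (card ?B) = real i * ?c"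
    using arg_cong[OF pushed_next_hits_back[OF i], of real] by (simp only: of_nat_mult)
  moreover have "real (n - i) * (?c - real (card (pushed (Suc i))))
      \<le> real (n - i) * (real (card ?F) + real (card ?H) + real (card ?B))"
    using calculation(1) by (rule mult_left_mono) simp
  ultimately have "real (n - i) * (?c - real (card (pushed (Suc i)))) \<le> (real k + 2 * real i) * ?c"
    unfolding distrib_left distrib_right by linarith
  also have "\<dots> \<le> (real k + 2 * real i) * real (card S)"
    using finite_S by (intro mult_left_mono of_nat_mono card_mono) (auto simp: pushed_def)
  finally have up: "real (n - i) * (push_prob i - push_prob (Suc i)) \<le> real k + 2 * real i"
    using card_S_pos by (simp add: push_prob_def field_simps)
  have "push_prob (Suc i) \<le> push_prob i"
    unfolding push_prob_def using card_pushed_diff[of i] by (intro divide_right_mono) linarith+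
  then have "real n / 2 * (push_prob i - push_prob (Suc i)) \<le> real (n - i) * (push_prob i - push_prob (Suc i))"
    using assms by (intro mult_right_mono) auto
  with up have "real n / 2 * (push_prob i - push_prob (Suc i)) \<le> real k + 2 * real i"
    by linarith
  then show ?thesis using i by (simp add: field_simps)
qed

lemma push_prob_le_exp:
  assumes "i \<le> n"
  shows "push_prob i \<le> exp (- (real i * real k + real i * (real i - 1) / 2) / real n)"
  using assms
proof (induction i)
  case (Suc i)
  have "push_prob (Suc i) \<le> push_prob i * (1 - (real k + real i) / real n)"
    using Suc.prems by (intro push_prob_Suc_le) simp
  also have "\<dots> \<le> push_prob i * exp (- (real k + real i) / real n)"
    using exp_ge_add_one_self[of "- (real k + real i) / real n"] push_prob_nonneg[of i]
    by (intro mult_left_mono) (simp_all only: minus_divide_left[symmetric] diff_conv_add_uminus)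
  also have "\<dots> \<le> exp (- (real i * real k + real i * (real i - 1) / 2) / real n)
      * exp (- (real k + real i) / real n)"
    using Suc by (intro mult_right_mono) auto
  also have "\<dots> = exp (- (real (Suc i) * real k + real (Suc i) * (real (Suc i) - 1) / 2) / real n)"
  proof -
    have "- (real i * real k + real i * (real i - 1) / 2) / real n + - (real k + real i) / real n
        = - (real (Suc i) * real k + real (Suc i) * (real (Suc i) - 1) / 2) / real n"
      using Suc.prems by (simp add: field_simps)
    then show ?thesis by (simp only: exp_add[symmetric])
  qed
  finally show ?case .
qed simp

lemma push_prob_ge:
  assumes "2 * i \<le> n"
  shows "1 - 2 * (real i * real k + real i * (real i - 1)) / real n \<le> push_prob i"
  using assms
proof (induction i)
  case (Suc i)
  then have "push_prob i - push_prob (Suc i) \<le> 2 * (real k + 2 * real i) / real n"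
    by (intro push_prob_Suc_ge) simp
  moreover have "1 - 2 * (real i * real k + real i * (real i - 1)) / real n \<le> push_prob i"
    using Suc by simp
  moreover have "2 * (real (Suc i) * real k + real (Suc i) * (real (Suc i) - 1)) / real n
      = 2 * (real i * real k + real i * (real i - 1)) / real n + 2 * (real k + 2 * real i) / real n"
    using Suc.prems by (simp add: field_simps)
  ultimately show ?case by linarith
qed simp

end

text \<open>
  This is the minimum of \<open>n / k\<close> and \<open>sqrt n\<close>, in a form that also makes sense for \<open>k = 0\<close>. It is where
  the exponent \<open>(i * k + i * i / 2) / n\<close> that governs \<open>push_prob i\<close> becomes of order \<open>1\<close>.
\<close>

definition cutoff :: "nat \<Rightarrow> nat \<Rightarrow> real" where
  "cutoff n k = real n / max (real k) (sqrt (real n))"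

context conj_invariant_perms
begin

abbreviation J :: real where
  "J \<equiv> cutoff n k"

context
  assumes n_pos: "1 \<le> n"
begin

lemma max_k_sqrt_bounds: "1 \<le> max (real k) (sqrt (real n))" "max (real k) (sqrt (real n)) \<le> real n"
proof -
  have "1 \<le> sqrt (real n)" using n_pos by simp
  moreover have "sqrt (real n) \<le> real n"
    using n_pos by (intro real_le_lsqrt) (auto simp: power2_eq_square)
  moreover have "real k \<le> real n" using k_le_n by simp
  ultimately show "1 \<le> max (real k) (sqrt (real n))" "max (real k) (sqrt (real n)) \<le> real n"
    by (auto intro: max.coboundedI2)
qed

lemma cutoff_ge_1: "1 \<le> J"
  using max_k_sqrt_bounds by (simp add: cutoff_def field_simps)

lemma cutoff_le_n: "J \<le> real n"
proof -
  have "real n / max (real k) (sqrt (real n)) \<le> real n / 1"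
    using max_k_sqrt_bounds by (intro divide_left_mono) auto
  then show ?thesis by (simp add: cutoff_def)
qed

lemma cutoff_sq_le: "J\<^sup>2 \<le> real n"
proof -
  have "J \<le> real n / sqrt (real n)"
    unfolding cutoff_def using n_pos max_k_sqrt_bounds(1) by (intro divide_left_mono mult_pos_pos) auto
  then have "J \<le> sqrt (real n)" by (simp add: real_div_sqrt)
  then have "J\<^sup>2 \<le> (sqrt (real n))\<^sup>2" using cutoff_ge_1 by (intro power_mono) auto
  then show ?thesis by simp
qed

lemma k_le_cutoff: "real k / real n \<le> 1 / J"
  using n_pos by (simp add: cutoff_def divide_right_mono)

text \<open>
  Which part of the exponent in \<open>push_prob_le_exp\<close> is used depends on whether fixed points
  (\<open>J = n / k\<close>) or the other points (\<open>J = sqrt n\<close>) determine the threshold.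
\<close>

lemma push_prob_le_cutoff:
  assumes "1 \<le> i" "i \<le> n"
  shows "push_prob i \<le> 4 * J / real i"
proof (cases "real i \<le> 4 * J")
  case True
  then have "1 \<le> 4 * J / real i" using assms by (simp add: field_simps)
  then show ?thesis using push_prob_le_1[of i] by linarith
next
  case False
  then have i: "4 < i" using cutoff_ge_1 by linarith
  have exp_le: "exp (- x) \<le> 1 / x" if "0 < x" for x :: real
  proof -
    have "x \<le> exp x" using exp_ge_add_one_self[of x] by linarith
    then show ?thesis using that by (simp add: exp_minus field_simps)
  qed
  have q: "push_prob i \<le> exp (- ((real i * real k + real i * (real i - 1) / 2) / real n))"
    using push_prob_le_exp[OF assms(2)] by (simp only: minus_divide_left)
  show ?thesis
  proof (cases "sqrt (real n) \<le> real k")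
    case True
    then have J: "J = real n / real k" by (simp add: cutoff_def max_def)
    have iJ: "real i / J = real i * real k / real n" by (simp add: J)
    note q
    also have "exp (- ((real i * real k + real i * (real i - 1) / 2) / real n)) \<le> exp (- (real i / J))"
      unfolding iJ exp_le_cancel_iff neg_le_iff_le using i by (intro divide_right_mono) auto
    also have "\<dots> \<le> 1 / (real i / J)"
      using i cutoff_ge_1 by (intro exp_le) auto
    also have "\<dots> = J / real i" by simp
    also have "\<dots> \<le> 4 * J / real i" using cutoff_ge_1 by (intro divide_right_mono) auto
    finally show ?thesis .
  next
    case nk: False
    then have J: "J = sqrt (real n)" by (simp add: cutoff_def max_def real_div_sqrt)
    then have n: "real n = J\<^sup>2" by simp
    let ?x = "(real i)\<^sup>2 / (4 * real n)"
    have "real i * 2 \<le> real i * real i" using i by (intro mult_left_mono) auto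
    then have "(real i)\<^sup>2 / 4 \<le> real i * (real i - 1) / 2"
      by (simp add: power2_eq_square right_diff_distrib)
    also have "\<dots> \<le> real i * real k + real i * (real i - 1) / 2" by simp
    finally have "(real i)\<^sup>2 / 4 / real n \<le> (real i * real k + real i * (real i - 1) / 2) / real n"
      by (intro divide_right_mono) auto
    then have "exp (- ((real i * real k + real i * (real i - 1) / 2) / real n)) \<le> exp (- ?x)"
      by (simp only: exp_le_cancel_iff neg_le_iff_le divide_divide_eq_left)
    with q have "push_prob i \<le> exp (- ?x)" by (rule order_trans)
    also have "\<dots> \<le> 1 / ?x" using i n_pos by (intro exp_le) auto
    also have "\<dots> = (4 * J / real i) * (J / real i)"
      unfolding n using i by (simp add: field_simps power2_eq_square)
    also have "\<dots> \<le> (4 * J / real i) * 1"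
      using False cutoff_ge_1 i by (intro mult_left_mono) (auto simp: field_simps)
    finally show ?thesis by simp
  qed
qed

lemma push_prob_ge_cutoff: "1 - 4 * real i / J \<le> push_prob i"
proof (cases "J \<le> 4 * real i")
  case True
  then have "1 \<le> 4 * real i / J" using cutoff_ge_1 by (simp add: field_simps)
  then show ?thesis using push_prob_nonneg[of i] by linarith
next
  case False
  then have "2 * i \<le> n" using cutoff_le_n by linarith
  note push_prob_ge[OF this]
  moreover have "2 * (real i * real k + real i * (real i - 1)) / real n \<le> 4 * real i / J"
  proof -
    have "real i * real k / real n \<le> real i * (1 / J)"
      unfolding times_divide_eq_right[symmetric] using k_le_cutoff by (intro mult_left_mono) auto
    moreover have "real i * (real i - 1) / real n \<le> real i / J"
    proof -
      have "real i * (real i - 1) / real n \<le> real i * J / real n"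
        using False cutoff_ge_1 by (intro divide_right_mono mult_left_mono) auto
      also have "\<dots> \<le> real i * J / J\<^sup>2"
        using cutoff_sq_le cutoff_ge_1 n_pos by (intro divide_left_mono mult_pos_pos) auto
      also have "\<dots> = real i / J" using cutoff_ge_1 by (simp add: power2_eq_square)
      finally show ?thesis .
    qed
    ultimately show ?thesis by (simp add: add_divide_distrib distrib_left)
  qed
  ultimately show ?thesis by linarith
qed


end

section \<open>First and second moments\<close>

definition mean :: "((nat \<Rightarrow> nat) \<Rightarrow> real) \<Rightarrow> real" where
  "mean f = (\<Sum>\<sigma>\<in>S. f \<sigma>) / real (card S)"

lemma mean_mono: "(\<And>\<sigma>. \<sigma> \<in> S \<Longrightarrow> f \<sigma> \<le> g \<sigma>) \<Longrightarrow> mean f \<le> mean g"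
  unfolding mean_def by (intro divide_right_mono sum_mono) auto

lemma mean_add: "mean (\<lambda>\<sigma>. f \<sigma> + g \<sigma>) = mean f + mean g"
  by (simp add: mean_def sum.distrib add_divide_distrib)

lemma mean_cmult: "mean (\<lambda>\<sigma>. c * f \<sigma>) = c * mean f"
  by (simp add: mean_def sum_distrib_left)

lemma mean_const: "mean (\<lambda>\<sigma>. c) = c"
  using card_S_pos by (simp add: mean_def)

lemma mean_sum: "mean (\<lambda>\<sigma>. \<Sum>i\<in>I. f i \<sigma>) = (\<Sum>i\<in>I. mean (f i))"
  unfolding mean_def by (subst sum.swap) (simp add: sum_divide_distrib)

lemma mean_of_bool: "mean (\<lambda>\<sigma>. of_bool (P \<sigma>)) = real (card {\<sigma> \<in> S. P \<sigma>}) / real (card S)"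
  using finite_S by (simp add: mean_def Int_def)

lemma mean_mem_high_low_records:
  assumes "i \<in> {1..n}"
  shows "mean (\<lambda>\<sigma>. of_bool (i \<in> high_low_records n \<sigma>)) = push_prob i / real i"
proof -
  have "{\<sigma> \<in> S. i \<in> high_low_records n \<sigma>} = {\<sigma> \<in> pushed i. low_record \<sigma> i}"
    using mem_high_low_records_iff[OF _ assms] by (auto simp: pushed_def)
  moreover have "real i * real (card {\<sigma> \<in> pushed i. low_record \<sigma> i}) = real (card (pushed i))"
    using arg_cong[OF card_pushed_low_record[OF assms], of real] by (simp only: of_nat_mult)
  moreover from this have "real (card {\<sigma> \<in> pushed i. low_record \<sigma> i}) = real (card (pushed i)) / real i"
    using assms by (simp add: field_simps)
  ultimately show ?thesis
    by (simp add: mean_of_bool push_prob_def)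
qed

lemma mean_mem_high_low_records2_less:
  assumes "i \<in> {1..n}" "j \<in> {1..n}" "i < j"
  shows "mean (\<lambda>\<sigma>. of_bool (i \<in> high_low_records n \<sigma> \<and> j \<in> high_low_records n \<sigma>)) \<le> 1 / real i * (1 / real j)"
proof -
  let ?E = "{\<sigma> \<in> pushed j. low_record \<sigma> i \<and> low_record \<sigma> j}"
  have "{\<sigma> \<in> S. i \<in> high_low_records n \<sigma> \<and> j \<in> high_low_records n \<sigma>} = ?E"
    using mem_high_low_records_iff[OF _ assms(1)] mem_high_low_records_iff[OF _ assms(2)]
      pushed_antimono[of i j] assms(3) by (auto simp: pushed_def)
  then have "mean (\<lambda>\<sigma>. of_bool (i \<in> high_low_records n \<sigma> \<and> j \<in> high_low_records n \<sigma>))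
      = real (card ?E) / real (card S)"
    by (simp only: mean_of_bool)
  also have "real (card ?E) = real (card (pushed j)) / (real i * real j)"
    using arg_cong[OF card_pushed_low_record2[OF assms], of real] assms
    by (simp add: field_simps)
  also have "\<dots> / real (card S) = push_prob j * (1 / real i * (1 / real j))"
    by (simp add: push_prob_def)
  also have "\<dots> \<le> 1 * (1 / real i * (1 / real j))"
    using push_prob_le_1 by (intro mult_right_mono) auto
  finally show ?thesis by simp
qed

lemma mean_mem_high_low_records2:
  assumes "i \<in> {1..n}" "j \<in> {1..n}" "i \<noteq> j"
  shows "mean (\<lambda>\<sigma>. of_bool (i \<in> high_low_records n \<sigma> \<and> j \<in> high_low_records n \<sigma>)) \<le> 1 / real i * (1 / real j)"
proof (cases "i < j")
  case True
  then show ?thesis using assms mean_mem_high_low_records2_less by blast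
next
  case False
  then show ?thesis
    using assms mean_mem_high_low_records2_less[of j i] by (simp add: conj_commute mult.commute)
qed

lemma card_Int_eq_sum: "finite I \<Longrightarrow> real (card (A \<inter> I)) = (\<Sum>i\<in>I. of_bool (i \<in> A))"
  by (simp add: Int_commute)

lemma mean_card_high_low_records:
  assumes "I \<subseteq> {1..n}"
  shows "mean (\<lambda>\<sigma>. real (card (high_low_records n \<sigma> \<inter> I))) = (\<Sum>i\<in>I. push_prob i / real i)"
proof -
  have "finite I" using assms finite_subset by blast
  then have "mean (\<lambda>\<sigma>. real (card (high_low_records n \<sigma> \<inter> I)))
      = (\<Sum>i\<in>I. mean (\<lambda>\<sigma>. of_bool (i \<in> high_low_records n \<sigma>)))"
    by (simp only: card_Int_eq_sum mean_sum)
  also have "\<dots> = (\<Sum>i\<in>I. push_prob i / real i)"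
    using assms by (intro sum.cong mean_mem_high_low_records) auto
  finally show ?thesis .
qed

text \<open>
  The bound is that for independent indicators with expectations \<open>1 / i\<close>, because distinct \<open>i\<close> and
  \<open>j\<close> are both high low records with probability at most \<open>1 / i * (1 / j)\<close>.
\<close>

lemma mean_card_high_low_records_sq:
  assumes "I \<subseteq> {1..n}"
  shows "mean (\<lambda>\<sigma>. (real (card (high_low_records n \<sigma> \<inter> I)))\<^sup>2)
    \<le> (\<Sum>i\<in>I. 1 / real i) + (\<Sum>i\<in>I. 1 / real i)\<^sup>2"
proof -
  have fin: "finite I" using assms finite_subset by blast
  have "(real (card (high_low_records n \<sigma> \<inter> I)))\<^sup>2
      = (\<Sum>i\<in>I. \<Sum>j\<in>I. of_bool (i \<in> high_low_records n \<sigma> \<and> j \<in> high_low_records n \<sigma>))" for \<sigma>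
    unfolding card_Int_eq_sum[OF fin] power2_eq_square sum_product
    by (simp only: of_bool_conj)
  then have "mean (\<lambda>\<sigma>. (real (card (high_low_records n \<sigma> \<inter> I)))\<^sup>2)
      = (\<Sum>i\<in>I. \<Sum>j\<in>I. mean (\<lambda>\<sigma>. of_bool (i \<in> high_low_records n \<sigma> \<and> j \<in> high_low_records n \<sigma>)))"
    by (simp only: mean_sum)
  also have "\<dots> \<le> (\<Sum>i\<in>I. \<Sum>j\<in>I. (if j = i then 1 / real i else 0) + 1 / real i * (1 / real j))"
  proof (intro sum_mono)
    fix i j assume "i \<in> I" "j \<in> I"
    then have ij: "i \<in> {1..n}" "j \<in> {1..n}" using assms by auto
    show "mean (\<lambda>\<sigma>. of_bool (i \<in> high_low_records n \<sigma> \<and> j \<in> high_low_records n \<sigma>))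
        \<le> (if j = i then 1 / real i else 0) + 1 / real i * (1 / real j)"
    proof (cases "i = j")
      case True
      have "push_prob i / real i \<le> 1 / real i" using push_prob_le_1 by (intro divide_right_mono) auto
      moreover have "0 \<le> 1 / (real j * real j)" by simp
      ultimately show ?thesis
        using True mean_mem_high_low_records[OF ij(1)] by (simp add: add_increasing2)
    next
      case False
      then show ?thesis using mean_mem_high_low_records2[OF ij] by simp
    qed
  qed
  also have "\<dots> = (\<Sum>i\<in>I. 1 / real i) + (\<Sum>i\<in>I. 1 / real i)\<^sup>2"
    using fin by (simp add: sum.distrib power2_eq_square sum_product)
  finally show ?thesis .
qed

lemma mean_abs_le:
  assumes "mean (\<lambda>\<sigma>. (f \<sigma>)\<^sup>2) \<le> s\<^sup>2" "0 < s"
  shows "mean (\<lambda>\<sigma>. \<bar>f \<sigma>\<bar>) \<le> s"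
proof -
  \<comment> \<open>Young's inequality replaces the Cauchy-Schwarz inequality.\<close>
  have "\<bar>x\<bar> \<le> 1 / (2 * s) * x\<^sup>2 + s / 2" for x :: real
  proof -
    have "0 \<le> (\<bar>x\<bar> - s)\<^sup>2" by simp
    then have "\<bar>x\<bar> * (2 * s) \<le> x\<^sup>2 + s\<^sup>2" by (simp add: power2_diff algebra_simps)
    then have "\<bar>x\<bar> \<le> (x\<^sup>2 + s\<^sup>2) / (2 * s)" using assms(2) by (simp add: pos_le_divide_eq)
    then show ?thesis using assms(2) by (simp add: add_divide_distrib power2_eq_square)
  qed
  then have "mean (\<lambda>\<sigma>. \<bar>f \<sigma>\<bar>) \<le> mean (\<lambda>\<sigma>. 1 / (2 * s) * (f \<sigma>)\<^sup>2 + s / 2)"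
    by (intro mean_mono)
  also have "\<dots> = 1 / (2 * s) * mean (\<lambda>\<sigma>. (f \<sigma>)\<^sup>2) + s / 2"
    by (simp only: mean_add mean_cmult mean_const)
  also have "\<dots> \<le> 1 / (2 * s) * s\<^sup>2 + s / 2"
    using assms by (intro add_right_mono mult_left_mono) auto
  also have "\<dots> = s" using assms(2) by (simp add: power2_eq_square)
  finally show ?thesis .
qed

end

lemma sum_inverse_squares_le:
  assumes "1 \<le> m" "m \<le> n"
  shows "(\<Sum>i\<in>{m<..n}. 1 / (real i)\<^sup>2) \<le> 1 / real m - 1 / real n"
  using assms(2)
proof (induction n rule: dec_induct)
  case (step n)
  have "{m<..Suc n} = insert (Suc n) {m<..n}" using step by auto
  then have "(\<Sum>i\<in>{m<..Suc n}. 1 / (real i)\<^sup>2) = 1 / (real (Suc n))\<^sup>2 + (\<Sum>i\<in>{m<..n}. 1 / (real i)\<^sup>2)"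
    by simp
  also have "\<dots> \<le> 1 / (real (Suc n))\<^sup>2 + (1 / real m - 1 / real n)"
    using step.IH by simp
  also have "1 / (real (Suc n))\<^sup>2 \<le> 1 / real n - 1 / real (Suc n)"
    using step assms(1) by (simp add: divide_simps power2_eq_square)
  finally show ?case by simp
qed simp

lemma harm_le_1_plus_ln:
  assumes "1 \<le> m"
  shows "(\<Sum>i\<in>{1..m}. 1 / real i) \<le> 1 + ln (real m)"
  using euler_mascheroni_sequence_decreasing[of 1 m] assms by (simp add: harm_def inverse_eq_divide)

lemma ln_le_harm_sum: "ln (real m + 1) \<le> (\<Sum>i\<in>{1..m}. 1 / real i)"
  using ln_le_harm[of m] by (simp add: harm_def inverse_eq_divide)

context conj_invariant_perms
begin

context
  assumes n_pos: "1 \<le> n"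
begin

text \<open>
  The second moment method is applied to the records up to \<open>J\<close> only, where the bound
  \<open>push_prob i \<le> 1\<close> behind the second moment is sharp enough. The later ones are few in the mean,
  so that the first moment suffices for them.
\<close>

lemma mean_abs_high_low_records:
  "mean (\<lambda>\<sigma>. \<bar>real (card (high_low_records n \<sigma>)) - ln J\<bar>) \<le> sqrt (2 + 11 * ln J) + 8"
proof -
  note J1 = cutoff_ge_1[OF n_pos]
  define L where "L = ln J"
  define m where "m = nat \<lfloor>J\<rfloor>"
  have m: "real m \<le> J" "J < real m + 1" "1 \<le> m" "m \<le> n"
    using J1 cutoff_le_n[OF n_pos] unfolding m_def by linarith+
  have L0: "0 \<le> L" using J1 by (simp add: L_def)
  define H where "H = (\<Sum>i\<in>{1..m}. 1 / real i)"
  have "H \<le> 1 + ln (real m)" unfolding H_def using m(3) by (rule harm_le_1_plus_ln)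
  also have "ln (real m) \<le> L" unfolding L_def using m by (intro ln_mono) auto
  finally have H_le: "H \<le> 1 + L" by simp
  have "L \<le> ln (real m + 1)" unfolding L_def using m J1 by (intro ln_mono) auto
  also have "\<dots> \<le> H" unfolding H_def by (rule ln_le_harm_sum)
  finally have H_ge: "L \<le> H" .
  let ?Y = "\<lambda>\<sigma>. real (card (high_low_records n \<sigma> \<inter> {1..m}))"
  let ?Z = "\<lambda>\<sigma>. real (card (high_low_records n \<sigma> \<inter> {m<..n}))"
  have sub: "{1..m} \<subseteq> {1..n}" using m by auto
  have "H - 4 \<le> H - 4 * real m / J" using m J1 by (simp add: field_simps)
  also have "\<dots> = (\<Sum>i\<in>{1..m}. 1 / real i - 4 / J)"
    by (simp add: H_def sum_subtractf)
  also have "\<dots> \<le> (\<Sum>i\<in>{1..m}. push_prob i / real i)"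
  proof (rule sum_mono)
    fix i assume i: "i \<in> {1..m}"
    have "(1 - 4 * real i / J) / real i \<le> push_prob i / real i"
      using push_prob_ge_cutoff[OF n_pos] by (intro divide_right_mono) auto
    then show "1 / real i - 4 / J \<le> push_prob i / real i"
      using i by (simp add: diff_divide_distrib)
  qed
  also have "\<dots> = mean ?Y" using mean_card_high_low_records[OF sub] by simp
  finally have Y1: "L - 4 \<le> mean ?Y" using H_ge by linarith
  have "mean (\<lambda>\<sigma>. (?Y \<sigma>)\<^sup>2) \<le> H + H\<^sup>2"
    unfolding H_def by (rule mean_card_high_low_records_sq[OF sub])
  also have "\<dots> \<le> (1 + L) + (1 + L)\<^sup>2"
    using H_le H_ge L0 by (intro add_mono power_mono) auto
  finally have Y2: "mean (\<lambda>\<sigma>. (?Y \<sigma>)\<^sup>2) \<le> (1 + L) + (1 + L)\<^sup>2" .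
  have "(\<lambda>\<sigma>. (?Y \<sigma> - L)\<^sup>2) = (\<lambda>\<sigma>. (?Y \<sigma>)\<^sup>2 + ((- 2 * L) * ?Y \<sigma> + L\<^sup>2))"
    by (simp add: fun_eq_iff power2_diff)
  then have "mean (\<lambda>\<sigma>. (?Y \<sigma> - L)\<^sup>2) = mean (\<lambda>\<sigma>. (?Y \<sigma>)\<^sup>2) + ((- 2 * L) * mean ?Y + L\<^sup>2)"
    by (simp only: mean_add mean_cmult mean_const)
  \<comment> \<open>The terms of order \<open>L\<^sup>2\<close> cancel, which leaves \<open>2 + 11 * L\<close>.\<close>
  also have "\<dots> \<le> ((1 + L) + (1 + L)\<^sup>2) + (- 2 * L * (L - 4) + L\<^sup>2)"
    using Y1 Y2 L0 by (intro add_mono mult_left_mono_neg) auto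
  also have "\<dots> = (sqrt (2 + 11 * L))\<^sup>2"
    using L0 by (simp add: power2_eq_square algebra_simps)
  finally have Y: "mean (\<lambda>\<sigma>. \<bar>?Y \<sigma> - L\<bar>) \<le> sqrt (2 + 11 * L)"
    using L0 by (intro mean_abs_le) auto
  have "mean ?Z = (\<Sum>i\<in>{m<..n}. push_prob i / real i)"
    using m by (intro mean_card_high_low_records) auto
  also have "\<dots> \<le> (\<Sum>i\<in>{m<..n}. 4 * J * (1 / (real i)\<^sup>2))"
  proof (rule sum_mono)
    fix i assume i: "i \<in> {m<..n}"
    have "push_prob i / real i \<le> (4 * J / real i) / real i"
      using i by (intro divide_right_mono push_prob_le_cutoff[OF n_pos]) auto
    then show "push_prob i / real i \<le> 4 * J * (1 / (real i)\<^sup>2)"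
      by (simp add: power2_eq_square)
  qed
  also have "\<dots> = 4 * J * (\<Sum>i\<in>{m<..n}. 1 / (real i)\<^sup>2)"
    by (simp only: sum_distrib_left)
  also have "\<dots> \<le> 4 * J * (1 / real m)"
  proof (rule mult_left_mono)
    have "0 \<le> 1 / real n" by simp
    then show "(\<Sum>i\<in>{m<..n}. 1 / (real i)\<^sup>2) \<le> 1 / real m"
      using sum_inverse_squares_le[OF m(3,4)] by linarith
  qed (use J1 in simp)
  also have "\<dots> \<le> 8" using m by (simp add: field_simps)
  finally have Z: "mean ?Z \<le> 8" .
  have "real (card (high_low_records n \<sigma>)) = ?Y \<sigma> + ?Z \<sigma>" for \<sigma>
  proof -
    have "high_low_records n \<sigma> = (high_low_records n \<sigma> \<inter> {1..m}) \<union> (high_low_records n \<sigma> \<inter> {m<..n})"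
      unfolding high_low_records_def by auto
    then have "card (high_low_records n \<sigma>)
        = card ((high_low_records n \<sigma> \<inter> {1..m}) \<union> (high_low_records n \<sigma> \<inter> {m<..n}))" by (rule arg_cong)
    also have "\<dots> = card (high_low_records n \<sigma> \<inter> {1..m}) + card (high_low_records n \<sigma> \<inter> {m<..n})"
      by (intro card_Un_disjoint) auto
    finally show ?thesis by simp
  qed
  then have "mean (\<lambda>\<sigma>. \<bar>real (card (high_low_records n \<sigma>)) - L\<bar>) \<le> mean (\<lambda>\<sigma>. \<bar>?Y \<sigma> - L\<bar> + ?Z \<sigma>)"
    by (intro mean_mono) (simp add: abs_if)
  also have "\<dots> \<le> sqrt (2 + 11 * L) + 8"
    using Y Z by (simp only: mean_add)
  finally show ?thesis by (simp only: L_def)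
qed

lemma mean_inv: "mean (\<lambda>\<sigma>. f (inv \<sigma>)) = mean f"
proof -
  have "bij_betw inv S S"
    by (rule bij_betwI[of _ _ _ inv])
       (auto simp: inv_closed intro!: permutes_inv_inv[OF permutes])
  then show ?thesis
    unfolding mean_def by (subst sum.reindex_bij_betw[of inv S S f]) auto
qed

text \<open>
  The triangle inequality for the two copies of \<open>mean_abs_high_low_records\<close>, one of them composed
  with inversion, which preserves the mean.
\<close>

lemma mean_abs_low_records:
  "mean (\<lambda>\<sigma>. \<bar>real (low_records n \<sigma>) - 2 * ln J\<bar>) \<le> 17 + 2 * sqrt (2 + 11 * ln J)"
proof -
  let ?f = "\<lambda>\<sigma>. \<bar>real (card (high_low_records n \<sigma>)) - ln J\<bar>"
  have "mean (\<lambda>\<sigma>. \<bar>real (low_records n \<sigma>) - 2 * ln J\<bar>) \<le> mean (\<lambda>\<sigma>. ?f \<sigma> + (?f (inv \<sigma>) + 1))"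
  proof (rule mean_mono)
    fix \<sigma> assume "\<sigma> \<in> S"
    note low_records_near_high_low_records[OF permutes[OF this]]
    then show "\<bar>real (low_records n \<sigma>) - 2 * ln J\<bar> \<le> ?f \<sigma> + (?f (inv \<sigma>) + 1)"
      by linarith
  qed
  also have "\<dots> = mean ?f + (mean ?f + 1)"
    by (simp only: mean_add mean_const mean_inv[of ?f])
  also have "\<dots> \<le> 17 + 2 * sqrt (2 + 11 * ln J)"
    using mean_abs_high_low_records by simp
  finally show ?thesis .
qed

text \<open>
  Markov's inequality. The event \<open>Q\<close> is left open because each regime centres and scales the number
  of low records in its own way.
\<close>

lemma low_records_tail:
  assumes Q: "\<And>\<sigma>. \<sigma> \<in> S \<Longrightarrow> Q \<sigma> \<Longrightarrow> y \<le> \<bar>real (low_records n \<sigma>) - 2 * ln J\<bar>"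
    and y: "0 < y"
  shows "real (card {\<sigma> \<in> S. Q \<sigma>}) / real (card S) \<le> (17 + 2 * sqrt (2 + 11 * ln J)) / y"
proof -
  have "mean (\<lambda>\<sigma>. of_bool (Q \<sigma>)) \<le> mean (\<lambda>\<sigma>. 1 / y * \<bar>real (low_records n \<sigma>) - 2 * ln J\<bar>)"
    using Q y by (intro mean_mono) (simp add: field_simps)
  also have "\<dots> \<le> 1 / y * (17 + 2 * sqrt (2 + 11 * ln J))"
    unfolding mean_cmult using y by (intro mult_left_mono mean_abs_low_records) auto
  finally show ?thesis by (simp add: mean_of_bool)
qed

end

end


section \<open>Convergence of the number of low records\<close>

lemma t_cyclic_perms_conj_invariant:
  assumes "1 \<le> n" "t_cyclic_perms n t \<noteq> {}"
  shows "conj_invariant_perms n (t 1) (t_cyclic_perms n t)"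
proof
  fix \<sigma> assume \<sigma>: "\<sigma> \<in> t_cyclic_perms n t"
  then show p: "\<sigma> permutes {1..n}" by (simp add: t_cyclic_perms_def)
  show "relabel a b \<sigma> \<in> t_cyclic_perms n t" if "a \<in> {1..n}" "b \<in> {1..n}" for a b
    using \<sigma> relabel_permutes[OF p that] num_cycles_relabel[OF that]
    by (simp add: t_cyclic_perms_def)
  show "inv \<sigma> \<in> t_cyclic_perms n t"
    using \<sigma> permutes_inv[OF p] num_cycles_inv[OF p] by (simp add: t_cyclic_perms_def)
  show "card {c \<in> {1..n}. \<sigma> c = c} = t 1"
    using \<sigma> num_cycles_1_eq_card_fixed[OF p] assms(1) by (simp add: t_cyclic_perms_def)
qed (rule assms(2))

lemma low_records_tail_prob:
  assumes n: "1 \<le> n" and M: "prob_space M"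
    and meas: "\<tau> \<in> M \<rightarrow>\<^sub>M count_space (t_cyclic_perms n t)"
    and unif: "distr M (count_space (t_cyclic_perms n t)) \<tau> = uniform_count_measure (t_cyclic_perms n t)"
    and Q: "\<And>\<sigma>. Q \<sigma> \<Longrightarrow> y \<le> \<bar>real (low_records n \<sigma>) - 2 * ln (cutoff n (t 1))\<bar>"
    and y: "0 < y"
  shows "measure M {\<omega> \<in> space M. Q (\<tau> \<omega>)} \<le> (17 + 2 * sqrt (2 + 11 * ln (cutoff n (t 1)))) / y"
proof -
  let ?S = "t_cyclic_perms n t"
  have in_S: "\<tau> \<omega> \<in> ?S" if "\<omega> \<in> space M" for \<omega>
    using measurable_space[OF meas that] by simp
  have "?S \<noteq> {}" using prob_space.not_empty[OF M] in_S by auto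
  then interpret conj_invariant_perms n "t 1" ?S
    using n by (intro t_cyclic_perms_conj_invariant)
  have "{\<omega> \<in> space M. Q (\<tau> \<omega>)} = \<tau> -` {\<sigma> \<in> ?S. Q \<sigma>} \<inter> space M"
    using in_S by auto
  then have "measure M {\<omega> \<in> space M. Q (\<tau> \<omega>)} = measure (distr M (count_space ?S) \<tau>) {\<sigma> \<in> ?S. Q \<sigma>}"
    using meas by (simp add: measure_distr)
  also have "\<dots> = real (card {\<sigma> \<in> ?S. Q \<sigma>}) / real (card ?S)"
    unfolding unif using finite_S by (intro measure_uniform_count_measure) auto
  also have "\<dots> \<le> (17 + 2 * sqrt (2 + 11 * ln (cutoff n (t 1)))) / y"
    using Q y by (intro low_records_tail[OF n])
  finally show ?thesis .
qed

text \<open>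
  A deviation \<open>y\<close> that is linear in \<open>x = ln J\<close> beats the bound on the expected distance, which is of
  order \<open>sqrt x\<close>; the constant \<open>c\<close> absorbs a bounded error in the centring.
\<close>

lemma tail_bound_tendsto_0:
  assumes "0 < a"
  shows "((\<lambda>x::real. (17 + 2 * sqrt (2 + 11 * x)) / (a * x - c)) \<longlongrightarrow> 0) at_top"
  using assms by real_asymp

lemma ln_cutoff:
  assumes "1 \<le> n"
  shows "ln (cutoff n k) = ln (real n) - ln (max (real k) (sqrt (real n)))"
  unfolding cutoff_def using assms by (intro ln_divide_pos) (auto simp: less_max_iff_disj)

theorem theorem2p11:
  fixes t :: "nat \<Rightarrow> nat \<Rightarrow> nat"
    and M :: "nat \<Rightarrow> 'a measure"
    and \<tau> :: "nat \<Rightarrow> 'a \<Rightarrow> (nat \<Rightarrow> nat)"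
  assumes "\<And>n. n \<ge> 1 \<Longrightarrow> cycle_type n (t n)"
    and "\<And>n. n \<ge> 1 \<Longrightarrow> prob_space (M n)"
    and "\<And>n. n \<ge> 1 \<Longrightarrow> \<tau> n \<in> M n \<rightarrow>\<^sub>M count_space (t_cyclic_perms n (t n))"
    and "\<And>n. n \<ge> 1 \<Longrightarrow>
           distr (M n) (count_space (t_cyclic_perms n (t n))) (\<tau> n)
             = uniform_count_measure (t_cyclic_perms n (t n))"
  shows "((\<lambda>n. real (t n 1)) \<in> O(\<lambda>n. sqrt (real n)) \<longrightarrow>
           tendsto_in_prob M (\<lambda>n \<omega>. real (low_records n (\<tau> n \<omega>)) / ln (real n)) 1) \<and>
         ((\<lambda>n. sqrt (real n)) \<in> o(\<lambda>n. real (t n 1)) \<and>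
           (\<lambda>n. real (t n 1)) \<in> o(\<lambda>n. real n) \<longrightarrow>
           tendsto_in_prob M
             (\<lambda>n \<omega>. real (low_records n (\<tau> n \<omega>)) / (ln (real n) - ln (real (t n 1)))) 2) \<and>
         ((\<lambda>n. real (t n 1)) \<in> \<Theta>(\<lambda>n. real n) \<longrightarrow>
           bounded_in_prob M (\<lambda>n \<omega>. real (low_records n (\<tau> n \<omega>))))"
proof -
  define L where "L n = ln (cutoff n (t n 1))" for n
  have L: "L n = ln (real n) - ln (max (real (t n 1)) (sqrt (real n)))" if "1 \<le> n" for n
    unfolding L_def using that by (rule ln_cutoff)
  have tail: "measure (M n) {\<omega> \<in> space (M n). Q (\<tau> n \<omega>)} \<le> (17 + 2 * sqrt (2 + 11 * x)) / y"
    if "1 \<le> n" "L n \<le> x" "0 < y"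
      "\<And>\<sigma>. Q \<sigma> \<Longrightarrow> y \<le> \<bar>real (low_records n \<sigma>) - 2 * L n\<bar>" for n x y Q
  proof -
    have "measure (M n) {\<omega> \<in> space (M n). Q (\<tau> n \<omega>)} \<le> (17 + 2 * sqrt (2 + 11 * L n)) / y"
      unfolding L_def
      by (rule low_records_tail_prob[OF that(1) assms(2-4)]) (use that in \<open>auto simp: L_def\<close>)
    also have "\<dots> \<le> (17 + 2 * sqrt (2 + 11 * x)) / y"
      using that by (intro divide_right_mono) auto
    finally show ?thesis .
  qed
  have max_ge: "1 \<le> max (real (t n 1)) (sqrt (real n))" if "1 \<le> n" for n
    using that by (auto intro: max.coboundedI2)
  have ln_max_nonneg: "0 \<le> ln (max (real (t n 1)) (sqrt (real n)))" if "1 \<le> n" for n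
    using max_ge[OF that] by (rule ln_ge_zero)
  have ln_top: "filterlim (\<lambda>n. ln (real n)) at_top sequentially"
    by (rule filterlim_compose[OF ln_at_top filterlim_real_sequentially])
  show ?thesis
  proof (intro conjI impI)
    assume "(\<lambda>n. real (t n 1)) \<in> O(\<lambda>n. sqrt (real n))"
    then obtain C where C: "\<forall>\<^sub>F n in sequentially. real (t n 1) \<le> C * sqrt (real n)"
      by (elim landau_o.bigE) auto
    \<comment> \<open>With \<open>K \<ge> 1\<close>, the number \<open>K * sqrt n\<close> bounds both entries of the maximum in the cutoff.\<close>
    define K where "K = max C 1"
    show "tendsto_in_prob M (\<lambda>n \<omega>. real (low_records n (\<tau> n \<omega>)) / ln (real n)) 1"
      unfolding tendsto_in_prob_def
    proof (intro allI impI)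
      fix \<epsilon> :: real assume \<epsilon>: "0 < \<epsilon>"
      let ?g = "\<lambda>n. (17 + 2 * sqrt (2 + 11 * ln (real n))) / (\<epsilon> * ln (real n) - 2 * ln K)"
      have g: "?g \<longlonglongrightarrow> 0"
        by (rule filterlim_compose[OF tail_bound_tendsto_0[OF \<epsilon>] ln_top])
      have big: "\<forall>\<^sub>F n in sequentially. 2 * ln K / \<epsilon> < ln (real n)"
        using ln_top unfolding filterlim_at_top_dense by blast
      show "(\<lambda>n. measure (M n) {\<omega> \<in> space (M n).
          \<bar>real (low_records n (\<tau> n \<omega>)) / ln (real n) - 1\<bar> > \<epsilon>}) \<longlonglongrightarrow> 0"
      proof (rule tendsto_sandwich[OF _ _ tendsto_const g])
        show "\<forall>\<^sub>F n in sequentially. measure (M n) {\<omega> \<in> space (M n).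
            \<bar>real (low_records n (\<tau> n \<omega>)) / ln (real n) - 1\<bar> > \<epsilon>} \<le> ?g n"
          using C big eventually_ge_at_top[of 2]
        proof eventually_elim
          case (elim n)
          have n: "1 \<le> n" and ln_pos: "0 < ln (real n)" using elim by auto
          have lnK: "0 \<le> ln K" by (simp add: K_def ln_ge_zero)
          have "C * sqrt (real n) \<le> K * sqrt (real n)" "1 * sqrt (real n) \<le> K * sqrt (real n)"
            by (intro mult_right_mono; simp add: K_def)+
          then have "max (real (t n 1)) (sqrt (real n)) \<le> K * sqrt (real n)"
            using elim(1) by simp
          then have "ln (max (real (t n 1)) (sqrt (real n))) \<le> ln (K * sqrt (real n))"
            using max_ge[OF n] by (intro ln_mono) auto
          also have "\<dots> = ln K + ln (real n) / 2"
            using n by (simp add: ln_mult ln_sqrt K_def)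
          finally have lo: "ln (real n) - 2 * ln K \<le> 2 * L n" using L[OF n] by simp
          have "ln (sqrt (real n)) \<le> ln (max (real (t n 1)) (sqrt (real n)))"
            using n by (intro ln_mono) auto
          then have hi: "2 * L n \<le> ln (real n)" using L[OF n] n by (simp add: ln_sqrt)
          show ?case
          proof (rule tail[OF n])
            show "L n \<le> ln (real n)" using hi ln_pos by linarith
            show "0 < \<epsilon> * ln (real n) - 2 * ln K" using elim(2) \<epsilon> by (simp add: field_simps)
            fix \<sigma> assume "\<epsilon> < \<bar>real (low_records n \<sigma>) / ln (real n) - 1\<bar>"
            also have "\<dots> = \<bar>real (low_records n \<sigma>) - ln (real n)\<bar> / ln (real n)"
              using ln_pos by (simp add: diff_divide_distrib[symmetric] divide_diff_eq_iff)
            finally have "\<epsilon> * ln (real n) < \<bar>real (low_records n \<sigma>) - ln (real n)\<bar>"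
              using ln_pos by (simp add: pos_less_divide_eq)
            then show "\<epsilon> * ln (real n) - 2 * ln K \<le> \<bar>real (low_records n \<sigma>) - 2 * L n\<bar>"
              using lo hi by linarith
          qed
        qed
      qed simp
    qed
  next
    assume o: "(\<lambda>n. sqrt (real n)) \<in> o(\<lambda>n. real (t n 1)) \<and> (\<lambda>n. real (t n 1)) \<in> o(\<lambda>n. real n)"
    have "\<forall>\<^sub>F n in sequentially. sqrt (real n) \<le> real (t n 1)"
      using landau_o.smallD[OF conjunct1[OF o], of 1] by simp
    then have L_eq: "\<forall>\<^sub>F n in sequentially. L n = ln (real n) - ln (real (t n 1))"
      using eventually_ge_at_top[of 1] by eventually_elim (simp add: L max_absorb1)
    have L_top: "filterlim L at_top sequentially"
      unfolding filterlim_at_top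
    proof
      fix Z :: real
      have "\<forall>\<^sub>F n in sequentially. real (t n 1) \<le> exp (- Z) * real n"
        using landau_o.smallD[OF conjunct2[OF o], of "exp (- Z)"] by simp
      moreover have "\<forall>\<^sub>F n in sequentially. sqrt (real n) \<le> exp (- Z) * real n"
        by real_asymp
      ultimately show "\<forall>\<^sub>F n in sequentially. Z \<le> L n"
        using eventually_ge_at_top[of 1]
      proof eventually_elim
        case (elim n)
        then have "ln (max (real (t n 1)) (sqrt (real n))) \<le> ln (exp (- Z) * real n)"
          using max_ge[of n] by (intro ln_mono) auto
        also have "\<dots> = - Z + ln (real n)" using elim by (simp add: ln_mult)
        finally show ?case using L[of n] elim by simp
      qed
    qed
    show "tendsto_in_prob M
      (\<lambda>n \<omega>. real (low_records n (\<tau> n \<omega>)) / (ln (real n) - ln (real (t n 1)))) 2"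
      unfolding tendsto_in_prob_def
    proof (intro allI impI)
      fix \<epsilon> :: real assume \<epsilon>: "0 < \<epsilon>"
      \<comment> \<open>The subtraction of \<open>0\<close> fits the pattern of \<open>tail_bound_tendsto_0\<close>.\<close>
      let ?g = "\<lambda>n. (17 + 2 * sqrt (2 + 11 * L n)) / (\<epsilon> * L n - 0)"
      have g: "?g \<longlonglongrightarrow> 0"
        by (rule filterlim_compose[OF tail_bound_tendsto_0[OF \<epsilon>] L_top])
      have L_pos: "\<forall>\<^sub>F n in sequentially. 0 < L n"
        using L_top unfolding filterlim_at_top_dense by blast
      show "(\<lambda>n. measure (M n) {\<omega> \<in> space (M n).
          \<bar>real (low_records n (\<tau> n \<omega>)) / (ln (real n) - ln (real (t n 1))) - 2\<bar> > \<epsilon>}) \<longlonglongrightarrow> 0"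
      proof (rule tendsto_sandwich[OF _ _ tendsto_const g])
        show "\<forall>\<^sub>F n in sequentially. measure (M n) {\<omega> \<in> space (M n).
            \<bar>real (low_records n (\<tau> n \<omega>)) / (ln (real n) - ln (real (t n 1))) - 2\<bar> > \<epsilon>} \<le> ?g n"
          using L_eq L_pos eventually_ge_at_top[of 1]
        proof eventually_elim
          case (elim n)
          show ?case
            unfolding elim(1)[symmetric]
          proof (rule tail[OF elim(3) order_refl])
            show "0 < \<epsilon> * L n - 0" using elim(2) \<epsilon> by simp
            fix \<sigma> assume "\<epsilon> < \<bar>real (low_records n \<sigma>) / L n - 2\<bar>"
            also have "\<dots> = \<bar>real (low_records n \<sigma>) - 2 * L n\<bar> / L n"
              using elim(2) by (simp add: diff_divide_distrib[symmetric] divide_diff_eq_iff)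
            finally show "\<epsilon> * L n - 0 \<le> \<bar>real (low_records n \<sigma>) - 2 * L n\<bar>"
              using elim(2) by (simp add: pos_less_divide_eq)
          qed
        qed
      qed simp
    qed
  next
    assume "(\<lambda>n. real (t n 1)) \<in> \<Theta>(\<lambda>n. real n)"
    then obtain c where c: "0 < c" "\<forall>\<^sub>F n in sequentially. c * real n \<le> real (t n 1)"
      by (auto dest!: bigthetaD2 elim!: landau_omega.bigE)
    then obtain N where N: "\<And>n. N \<le> n \<Longrightarrow> c * real n \<le> real (t n 1)"
      by (auto simp: eventually_sequentially)
    \<comment> \<open>The supremum ranges over all \<open>n \<ge> 1\<close>: the second summand takes care of the \<open>n < N\<close>.\<close>
    define B where "B = \<bar>ln c\<bar> + ln (real N + 1)"
    have L_le: "L n \<le> B" if n: "1 \<le> n" for n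
    proof (cases "N \<le> n")
      case True
      have "ln (c * real n) \<le> ln (max (real (t n 1)) (sqrt (real n)))"
        using N[OF True] c(1) n by (intro ln_mono) auto
      then have "ln c + ln (real n) \<le> ln (max (real (t n 1)) (sqrt (real n)))"
        using c(1) n by (simp add: ln_mult)
      moreover have "0 \<le> ln (real N + 1)" by simp
      ultimately show ?thesis unfolding B_def L[OF n] by linarith
    next
      case False
      then have "ln (real n) \<le> ln (real N + 1)" using n by (intro ln_mono) auto
      then show ?thesis unfolding B_def L[OF n] using ln_max_nonneg[OF n] by linarith
    qed
    let ?P = "\<lambda>K n. measure (M n) {\<omega> \<in> space (M n). \<bar>real (low_records n (\<tau> n \<omega>))\<bar> > K}"
    let ?g = "\<lambda>K::real. (17 + 2 * sqrt (2 + 11 * B)) / (K - 2 * B)"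
    have P_le: "?P K n \<le> ?g K" if "2 * B < K" "1 \<le> n" for K n
    proof (rule tail[OF that(2) L_le[OF that(2)]])
      fix \<sigma> assume "K < \<bar>real (low_records n \<sigma>)\<bar>"
      then show "K - 2 * B \<le> \<bar>real (low_records n \<sigma>) - 2 * L n\<bar>"
        using L_le[OF that(2)] by linarith
    qed (use that in simp)
    show "bounded_in_prob M (\<lambda>n \<omega>. real (low_records n (\<tau> n \<omega>)))"
      unfolding bounded_in_prob_def
    proof (rule tendsto_sandwich[where f = "\<lambda>_. 0" and h = ?g])
      show "(?g \<longlongrightarrow> 0) at_top" by real_asymp
      show "\<forall>\<^sub>F K in at_top. 0 \<le> (SUP n\<in>{1..}. ?P K n)"
        using eventually_gt_at_top[of "2 * B"]
      proof eventually_elim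
        case (elim K)
        have "bdd_above (?P K ` {1..})"
          using P_le[OF elim] by (intro bdd_aboveI2[of _ _ "?g K"]) auto
        then show ?case by (rule cSUP_upper2[of _ _ 1]) auto
      qed
      show "\<forall>\<^sub>F K in at_top. (SUP n\<in>{1..}. ?P K n) \<le> ?g K"
        using eventually_gt_at_top[of "2 * B"]
      proof eventually_elim
        case (elim K)
        show ?case
        proof (rule cSUP_least)
          show "?P K n \<le> ?g K" if "n \<in> {1..}" for n
            using that by (intro P_le[OF elim]) simp
        qed simp
      qed
    qed simp
  qed
qed

end
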